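(* Let $X=(x_{ij})\in\mathbb{R}^{n\times m}$ be a real matrix with no zero column, let $0<\lambda<\lambda_{\max}:=\sum_{j\le m}\max_{i\le n}|x_{ij}|$ and let $\delta>0$. The bisection algorithm described in the context, run on input $(X,\lambda,\delta)$, returns dual variables $\hat\nu$ and primal variables $\hat U=(\hat u_{ij})$ such that for all $j\le m$ and all $i\le n$, $$|\hat\nu_j-\nu^*_j|\le\frac{\delta}{\lambda}\qquad\text{and}\qquad|\hat u_{ij}-u^*_{ij}|<\delta .$$ Furthermore, if $I(\hat t)=I^*$, where $\hat t$ is the slack variable returned by the algorithm, then for all $j\notin I(\hat t)$ one has $\hat U_j=U^*_j$ and $\hat\nu_j=\nu^*_j$.
   Context: $X_j$ denotes the $j$-th column of $X$, $\|\cdot\|_1$ is the $\ell_1$ norm on $\mathbb{R}^n$, $\|\cdot\|_F$ the Frobenius norm, $[a]^+=\max(a,0)$. Soft thresholding: $S_\mu(x)=[|x|-\mu]^+\operatorname{sign}(x)$, applied entrywise to vectors. $(U^*,t^* )$ is the unique minimizer of $t+\frac{1}{2\lambda}\|U-X\|_F^2$ over $U\in\mathbb{R}^{n\times m}$, $t\ge 0$ subject to $\|U_j\|_1\le t$ for all $j\le m$. Equivalently, $U^*=(u^*_{ij})$ is the proximal operator at $X$ of $\lambda$ times the norm $\|U\|_{1,1}=\max_j\|U_j\|_1$. The vector $\nu^*\in\mathbb{R}^m$ is the optimal dual variable (unique under the present assumptions) for the Lagrangian $t+\frac{1}{2\lambda}\|U-X\|_F^2+\sum_j\nu_j(\|U_j\|_1-t)$;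 that is, together with $(U^*,t^* )$ it satisfies the KKT conditions: for all $j$, $\|U^*_j\|_1\le t^*$, $\nu^*_j\ge0$, $\nu^*_j(\|U^*_j\|_1-t^* )=0$, $\frac1\lambda(U^*_j-X_j)\in-\nu^*_j\,\partial\|\cdot\|_1(U^*_j)$ (equivalently $U^*_j=S_{\lambda\nu^*_j}(X_j)$), and $\sum_j\nu^*_j=1$. The optimal active set $I^*$ is the set of indices $j$ with $\|U^*_j\|_1=t^*$, excluding by convention columns that are not thresholded (those with $U^*_j=X_j$). For $t\ge 0$ define $I(t)=\{j\le m:\ \|X_j\|_1>t\}$. For $0<t<\max_j\|X_j\|_1$ define $\nu_j(t)=0$ if $j\notin I(t)$, and, if $j\in I(t)$, let $\nu_j(t)$ be the unique $\nu>0$ with $\sum_{i\le n}[|x_{ij}|-\lambda\nu]^+=t$. Algorithm (exact arithmetic). Initialize $t_{\min}=0$, $t_{\max}=\max_j\|X_j\|_1$, $t=t_{\max}/2$. While $t_{\max}-t_{\min}>\delta$: compute $\nu_j(t)$ for all $j\le m$; if $\sum_{j\le m}\nu_j(t)>1$, set $t_{\min}=t$ and then replace $t$ by $(t+t_{\max})/2$; if $\sum_{j\le m}\nu_j(t)<1$, set $t_{\max}=t$ and then replace $t$ by $(t+t_{\min})/2$; if $\sum_{j\le m}\nu_j(t)=1$, stop. The output is: $\hat t$, the final value of $t$; $\hat\nu_j=\nu_j(\hat t)$ for $j\le m$; and $\hat U$ with columns $\hat U_j=S_{\lambda\hat\nu_j}(X_j)$. (An early exit of the algorithm for $\lambda\ge\lambda_{\max}$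 does not occur here.) *)

theory Defs
  imports "HOL-Analysis.Analysis" "HOL-Library.While_Combinator"
begin

text \<open>
  A matrix \<open>X\<close> with \<open>n\<close> rows and \<open>m\<close> columns is an element of \<open>real ^ 'm ^ 'n\<close>, with entries
  \<open>x\<^sub>i\<^sub>j = X $ i $ j\<close> and columns \<open>X\<^sub>j = column j X\<close>. On this type, the library's \<open>norm\<close> is the
  Euclidean norm of the vector of Euclidean norms of the rows, i.e. the Frobenius norm.
\<close>

definition norm1 :: "real ^ 'n \<Rightarrow> real" where
  "norm1 x = (\<Sum>i\<in>UNIV. \<bar>x $ i\<bar>)"

definition max_col_norm1 :: "real ^ 'm ^ 'n \<Rightarrow> real" where
  "max_col_norm1 X = Max (range (\<lambda>j. norm1 (column j X)))"

definition lambda_max :: "real ^ 'm ^ 'n \<Rightarrow> real" where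
  "lambda_max X = (\<Sum>j\<in>UNIV. Max (range (\<lambda>i. \<bar>X $ i $ j\<bar>)))"

definition soft :: "real \<Rightarrow> real \<Rightarrow> real" where
  "soft \<mu> x = max (\<bar>x\<bar> - \<mu>) 0 * sgn x"

definition soft_vec :: "real \<Rightarrow> real ^ 'n \<Rightarrow> real ^ 'n" where
  "soft_vec \<mu> x = (\<chi> i. soft \<mu> (x $ i))"

definition subdifferential :: "('a::real_inner \<Rightarrow> real) \<Rightarrow> 'a \<Rightarrow> 'a set" where
  "subdifferential f x = {g. \<forall>y. f x + g \<bullet> (y - x) \<le> f y}"


subsection \<open>The optimization problem\<close>

definition feasible :: "real ^ 'm ^ 'n \<Rightarrow> real \<Rightarrow> bool" where
  "feasible U t \<longleftrightarrow> 0 \<le> t \<and> (\<forall>j. norm1 (column j U) \<le> t)"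

definition objective :: "real ^ 'm ^ 'n \<Rightarrow> real \<Rightarrow> real ^ 'm ^ 'n \<Rightarrow> real \<Rightarrow> real" where
  "objective X lam U t = t + 1 / (2 * lam) * (norm (U - X))\<^sup>2"

definition primal_optimal :: "real ^ 'm ^ 'n \<Rightarrow> real \<Rightarrow> real ^ 'm ^ 'n \<Rightarrow> real \<Rightarrow> bool" where
  "primal_optimal X lam U t \<longleftrightarrow>
     is_arg_min (\<lambda>(V, s). objective X lam V s) (\<lambda>(V, s). feasible V s) (U, t)"

definition KKT ::
  "real ^ 'm ^ 'n \<Rightarrow> real \<Rightarrow> real ^ 'm ^ 'n \<Rightarrow> real \<Rightarrow> real ^ 'm \<Rightarrow> bool" where
  "KKT X lam U t \<nu> \<longleftrightarrow>
     (\<forall>j. norm1 (column j U) \<le> t \<and>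
          0 \<le> \<nu> $ j \<and>
          \<nu> $ j * (norm1 (column j U) - t) = 0 \<and>
          (1 / lam) *\<^sub>R (column j U - column j X)
            \<in> (\<lambda>g. - (\<nu> $ j) *\<^sub>R g) ` subdifferential norm1 (column j U)) \<and>
     (\<Sum>j\<in>UNIV. \<nu> $ j) = 1"

text \<open>Columns that are not thresholded are excluded, even if they attain \<open>t\<close>.\<close>

definition optimal_active_set ::
  "real ^ 'm ^ 'n \<Rightarrow> real ^ 'm ^ 'n \<Rightarrow> real \<Rightarrow> 'm set" where
  "optimal_active_set X U t = {j. norm1 (column j U) = t \<and> column j U \<noteq> column j X}"


subsection \<open>The bisection algorithm\<close>

definition active_set :: "real ^ 'm ^ 'n \<Rightarrow> real \<Rightarrow> 'm set" where
  "active_set X t = {j. norm1 (column j X) > t}"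

text \<open>Only meaningful for \<open>0 < t < max_col_norm1 X\<close>, where the description is unique.\<close>

definition dual_var :: "real ^ 'm ^ 'n \<Rightarrow> real \<Rightarrow> real \<Rightarrow> 'm \<Rightarrow> real" where
  "dual_var X lam t j =
     (if j \<in> active_set X t
      then THE \<nu>. 0 < \<nu> \<and> (\<Sum>i\<in>UNIV. max (\<bar>X $ i $ j\<bar> - lam * \<nu>) 0) = t
      else 0)"

text \<open>
  The loop state is \<open>(t\<^sub>m\<^sub>i\<^sub>n, t\<^sub>m\<^sub>a\<^sub>x, t, stop)\<close>, where \<open>stop\<close> records that the exit for
  \<open>\<Sum>\<^sub>j \<nu>\<^sub>j(t) = 1\<close> has been taken.
\<close>

type_synonym bisection_state = "real \<times> real \<times> real \<times> bool"

definition bisection_init :: "real ^ 'm ^ 'n \<Rightarrow> bisection_state" where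
  "bisection_init X = (0, max_col_norm1 X, max_col_norm1 X / 2, False)"

fun bisection_cond :: "real \<Rightarrow> bisection_state \<Rightarrow> bool" where
  "bisection_cond \<delta> (tmin, tmax, t, stop) \<longleftrightarrow> \<not> stop \<and> tmax - tmin > \<delta>"

fun bisection_step :: "real ^ 'm ^ 'n \<Rightarrow> real \<Rightarrow> bisection_state \<Rightarrow> bisection_state" where
  "bisection_step X lam (tmin, tmax, t, stop) =
     (let s = (\<Sum>j\<in>UNIV. dual_var X lam t j)
      in if s > 1 then (t, tmax, (t + tmax) / 2, False)
         else if s < 1 then (tmin, t, (t + tmin) / 2, False)
         else (tmin, tmax, t, True))"

fun bisection_output ::
  "real ^ 'm ^ 'n \<Rightarrow> real \<Rightarrow> bisection_state \<Rightarrow> real \<times> (real ^ 'm) \<times> (real ^ 'm ^ 'n)" where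
  "bisection_output X lam (tmin, tmax, t, stop) =
     (t,
      (\<chi> j. dual_var X lam t j),
      (\<chi> i j. soft_vec (lam * dual_var X lam t j) (column j X) $ i))"

text \<open>The result is \<open>None\<close> if the loop does not terminate.\<close>

definition bisection ::
  "real ^ 'm ^ 'n \<Rightarrow> real \<Rightarrow> real \<Rightarrow> (real \<times> (real ^ 'm) \<times> (real ^ 'm ^ 'n)) option" where
  "bisection X lam \<delta> =
     map_option (bisection_output X lam)
       (while_option (bisection_cond \<delta>) (bisection_step X lam) (bisection_init X))"

end

theory Submission imports Defs begin

text \<open>
  Fix a column \<open>x\<close> and write \<open>\<phi>(\<mu>) = (\<Sum>i. max (\<bar>x\<^sub>i\<bar> - \<mu>) 0)\<close>, the \<open>\<ell>\<^sub>1\<close> norm of the column after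
  soft thresholding at level \<open>\<mu>\<close>. As long as \<open>\<phi>\<close> is positive, at least one entry survives
  the thresholding, so \<open>\<phi>\<close> decreases with slope at most \<open>-1\<close>
  (\<open>shrunk_norm1_expanding\<close>). Hence the threshold \<open>\<lambda> \<nu>\<^sub>j(t)\<close> that brings the norm down to
  \<open>t\<close> is a nonincreasing and 1-Lipschitz function of \<open>t\<close>.

  The natural way to handle the active and the inactive columns together is the
  complementarity system \<open>\<nu> \<ge> 0\<close>, \<open>\<phi>(\<lambda> \<nu>) \<le> t\<close>, \<open>\<nu> (\<phi>(\<lambda> \<nu>) - t) = 0\<close>: for \<open>t > 0\<close> it has the
  single solution \<open>\<nu>\<^sub>j(t)\<close> (\<open>dual_var_complementarity\<close>, \<open>dual_var_eqI\<close>). The KKT conditions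
  contain this system. Indeed stationarity says that \<open>U\<^sup>*\<^sub>j\<close> is the soft thresholding of \<open>X\<^sub>j\<close> at
  level \<open>\<lambda> \<nu>\<^sup>*\<^sub>j\<close>, so \<open>\<phi>(\<lambda> \<nu>\<^sup>*\<^sub>j) = \<parallel>U\<^sup>*\<^sub>j\<parallel>\<^sub>1\<close>; and \<open>\<lambda> < \<lambda>\<^sub>m\<^sub>a\<^sub>x\<close> forces \<open>t\<^sup>* > 0\<close>. Therefore
  \<open>\<nu>\<^sup>*\<^sub>j = \<nu>\<^sub>j(t\<^sup>*)\<close>, and \<open>\<Sum>\<^sub>j \<nu>\<^sub>j(t\<^sup>*) = 1\<close>: the optimal \<open>t\<^sup>*\<close> is the root that the bisection
  looks for.

  Since \<open>\<Sum>\<^sub>j \<nu>\<^sub>j(t)\<close> is monotone, and strictly so where it is positive, the bisection keeps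
  \<open>t\<^sup>*\<close> bracketed and stops early only at \<open>t\<^sup>*\<close> itself. It ends with an interval of length at
  most \<open>\<delta>\<close> whose midpoint it returns, so \<open>\<bar>t - t\<^sup>*\<bar> \<le> \<delta>/2\<close> for the returned \<open>t\<close>. The Lipschitz
  bounds for \<open>\<lambda> \<nu>\<^sub>j(t)\<close> in \<open>t\<close> and for soft thresholding in its level transfer this error to
  \<open>\<nu>\<close> and \<open>U\<close>; the factor \<open>1/2\<close> yields the strict inequality for \<open>U\<close>.
\<close>

section \<open>The norm of a soft-thresholded vector\<close>

definition shrunk_norm1 :: "real \<Rightarrow> real ^ 'n \<Rightarrow> real" where
  "shrunk_norm1 \<mu> x = (\<Sum>i\<in>UNIV. max (\<bar>x $ i\<bar> - \<mu>) 0)"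

lemma shrunk_norm1_0: "shrunk_norm1 0 x = norm1 x"
  by (simp add: shrunk_norm1_def norm1_def)

lemma norm1_soft_vec: "0 \<le> \<mu> \<Longrightarrow> norm1 (soft_vec \<mu> x) = shrunk_norm1 \<mu> x"
  unfolding norm1_def soft_vec_def soft_def shrunk_norm1_def
  by (intro sum.cong) (auto simp: abs_mult sgn_if)

lemma soft_lipschitz_level: "\<bar>soft a x - soft b x\<bar> \<le> \<bar>a - b\<bar>"
  by (cases "x = 0"; cases "0 < x"; simp add: soft_def max_def abs_if)

lemma soft_add_sgn:
  assumes "0 \<le> \<mu>" and "u \<noteq> 0"
  shows "soft \<mu> (u + \<mu> * sgn u) = u"
proof (cases "0 < u")
  case True
  then show ?thesis using assms(1) by (simp add: soft_def)
next
  case False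
  then have "u < 0" using assms(2) by simp
  then show ?thesis using assms(1) by (simp add: soft_def)
qed

lemma shrunk_norm1_nonneg: "0 \<le> shrunk_norm1 \<mu> x"
  unfolding shrunk_norm1_def by (intro sum_nonneg) simp

lemma shrunk_norm1_antimono: "a \<le> b \<Longrightarrow> shrunk_norm1 b x \<le> shrunk_norm1 a x"
  unfolding shrunk_norm1_def by (intro sum_mono) auto

lemma shrunk_norm1_eq_0_iff: "shrunk_norm1 \<mu> x = 0 \<longleftrightarrow> (\<forall>i. \<bar>x $ i\<bar> \<le> \<mu>)"
  unfolding shrunk_norm1_def by (subst sum_nonneg_eq_0_iff) (auto simp: max_def)

text \<open>
  An entry that survives the larger threshold \<open>b\<close> contributes \<open>b - a\<close> to the difference, and
  no entry contributes a negative amount.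
\<close>

lemma shrunk_norm1_expanding:
  assumes "a \<le> b" and "0 < shrunk_norm1 b x"
  shows "b - a \<le> shrunk_norm1 a x - shrunk_norm1 b x"
proof -
  obtain k where k: "b < \<bar>x $ k\<bar>"
    using assms(2) shrunk_norm1_eq_0_iff[of b x] by (auto simp: not_le)
  let ?d = "\<lambda>i. max (\<bar>x $ i\<bar> - a) 0 - max (\<bar>x $ i\<bar> - b) 0"
  have "b - a = ?d k" using k assms(1) by simp
  also have "\<dots> \<le> (\<Sum>i\<in>UNIV. ?d i)"
    using assms(1) by (intro member_le_sum) auto
  also have "\<dots> = shrunk_norm1 a x - shrunk_norm1 b x"
    by (simp add: shrunk_norm1_def sum_subtractf)
  finally show ?thesis .
qed

lemma shrunk_norm1_inj:
  assumes "shrunk_norm1 a x = t" and "shrunk_norm1 b x = t" and "0 < t"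
  shows "a = b"
  using shrunk_norm1_expanding[of a b x] shrunk_norm1_expanding[of b a x] assms by linarith

lemma shrunk_norm1_attains:
  assumes "0 < t" and "t < norm1 x"
  obtains \<mu> where "0 < \<mu>" and "shrunk_norm1 \<mu> x = t"
proof -
  have "\<forall>i. \<bar>x $ i\<bar> \<le> norm1 x"
    unfolding norm1_def by (auto intro: member_le_sum)
  then have "shrunk_norm1 (norm1 x) x = 0" by (simp add: shrunk_norm1_eq_0_iff)
  moreover have "continuous_on {0..norm1 x} (\<lambda>\<mu>. shrunk_norm1 \<mu> x)"
    unfolding shrunk_norm1_def by (intro continuous_intros)
  ultimately obtain \<mu> where "0 \<le> \<mu>" "shrunk_norm1 \<mu> x = t"
    using IVT2'[of "\<lambda>\<mu>. shrunk_norm1 \<mu> x" "norm1 x" t 0] assms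
    by (auto simp: shrunk_norm1_0)
  moreover from this have "\<mu> \<noteq> 0" using assms(2) by (auto simp: shrunk_norm1_0)
  ultimately show ?thesis using that[of \<mu>] by simp
qed


section \<open>The dual variable as a function of the slack\<close>

lemma dual_var_active:
  assumes "0 < lam" and "0 < t" and "j \<in> active_set X t"
  shows "0 < dual_var X lam t j"
    and "shrunk_norm1 (lam * dual_var X lam t j) (column j X) = t"
proof -
  let ?P = "\<lambda>\<nu>. 0 < \<nu> \<and> (\<Sum>i\<in>UNIV. max (\<bar>X $ i $ j\<bar> - lam * \<nu>) 0) = t"
  have P_iff: "?P \<nu> \<longleftrightarrow> 0 < \<nu> \<and> shrunk_norm1 (lam * \<nu>) (column j X) = t" for \<nu>
    by (simp add: shrunk_norm1_def column_def)
  obtain \<mu> where \<mu>: "0 < \<mu>" "shrunk_norm1 \<mu> (column j X) = t"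
    using shrunk_norm1_attains[of t "column j X"] assms by (auto simp: active_set_def)
  have "?P (\<mu> / lam)" unfolding P_iff using \<mu> assms(1) by simp
  moreover have "\<nu> = \<mu> / lam" if "?P \<nu>" for \<nu>
    using that \<mu> assms shrunk_norm1_inj[of "lam * \<nu>" "column j X" t \<mu>]
    unfolding P_iff by (auto simp: field_simps)
  ultimately have "?P (THE \<nu>. ?P \<nu>)" by (rule theI)
  then have "?P (dual_var X lam t j)" using assms(3) by (simp add: dual_var_def)
  then show "0 < dual_var X lam t j"
    and "shrunk_norm1 (lam * dual_var X lam t j) (column j X) = t"
    unfolding P_iff by auto
qed

lemma dual_var_complementarity:
  assumes "0 < lam" and "0 < t"
  shows "0 \<le> dual_var X lam t j"
    and "shrunk_norm1 (lam * dual_var X lam t j) (column j X) \<le> t"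
    and "0 < dual_var X lam t j \<Longrightarrow>
      shrunk_norm1 (lam * dual_var X lam t j) (column j X) = t"
proof -
  have "dual_var X lam t j = 0" "norm1 (column j X) \<le> t" if "j \<notin> active_set X t"
    using that by (auto simp: dual_var_def active_set_def)
  then show "0 \<le> dual_var X lam t j"
    and "shrunk_norm1 (lam * dual_var X lam t j) (column j X) \<le> t"
    and "0 < dual_var X lam t j \<Longrightarrow>
      shrunk_norm1 (lam * dual_var X lam t j) (column j X) = t"
    using dual_var_active[OF assms, of j X]
    by (cases "j \<in> active_set X t"; force simp: shrunk_norm1_0)+
qed

text \<open>
  The system of complementarity conditions is monotone in the parameter \<open>t\<close>: from two solutions
  for \<open>s \<le> t\<close>, the expansion property bounds the difference of the thresholds on both sides.
  Taking \<open>s = t\<close> gives uniqueness of the solution.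
\<close>

lemma complementarity_compare:
  assumes "0 < s" and "s \<le> t"
    and "0 \<le> a" "shrunk_norm1 a x \<le> s" "0 < a \<Longrightarrow> shrunk_norm1 a x = s"
    and "0 \<le> b" "shrunk_norm1 b x \<le> t" "0 < b \<Longrightarrow> shrunk_norm1 b x = t"
  shows "b \<le> a" and "a - b \<le> t - s"
proof -
  show "b \<le> a"
  proof (rule ccontr)
    assume "\<not> b \<le> a"
    then show False using shrunk_norm1_expanding[of a b x] assms by auto
  qed
  show "a - b \<le> t - s"
  proof (cases "b < a")
    case True
    then show ?thesis using shrunk_norm1_expanding[of b a x] assms by auto
  next
    case False
    then show ?thesis using assms(2) by linarith
  qed
qed

lemma dual_var_eqI:
  assumes "0 < lam" and "0 < t"
    and "0 \<le> \<nu>" "shrunk_norm1 (lam * \<nu>) (column j X) \<le> t"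
    and "0 < \<nu> \<Longrightarrow> shrunk_norm1 (lam * \<nu>) (column j X) = t"
  shows "dual_var X lam t j = \<nu>"
proof -
  note d = dual_var_complementarity[OF assms(1,2), of X j]
  have sol: "0 \<le> lam * \<nu>" "0 < lam * \<nu> \<Longrightarrow> shrunk_norm1 (lam * \<nu>) (column j X) = t"
    "0 \<le> lam * dual_var X lam t j"
    "0 < lam * dual_var X lam t j \<Longrightarrow>
      shrunk_norm1 (lam * dual_var X lam t j) (column j X) = t"
    using assms(1,3,5) d(1,3) by (simp_all add: zero_less_mult_iff)
  have "lam * dual_var X lam t j \<le> lam * \<nu>"
    by (rule complementarity_compare(1)[OF assms(2) order_refl sol(1) assms(4) sol(2,3) d(2) sol(4)])
  moreover have "lam * \<nu> \<le> lam * dual_var X lam t j"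
    by (rule complementarity_compare(1)[OF assms(2) order_refl sol(3) d(2) sol(4,1) assms(4) sol(2)])
  ultimately show ?thesis using assms(1) by simp
qed

lemma dual_var_antimono:
  assumes "0 < lam" and "0 < s" and "s \<le> t"
  shows "dual_var X lam t j \<le> dual_var X lam s j"
    and "lam * (dual_var X lam s j - dual_var X lam t j) \<le> t - s"
proof -
  have t: "0 < t" using assms by simp
  have threshold: "0 \<le> lam * dual_var X lam r j"
    "0 < lam * dual_var X lam r j \<Longrightarrow>
      shrunk_norm1 (lam * dual_var X lam r j) (column j X) = r" if "0 < r" for r
    using dual_var_complementarity(1,3)[OF assms(1) that, of X j] assms(1)
    by (simp_all add: zero_less_mult_iff)
  note compare = complementarity_compare[OF assms(2,3)
      threshold(1)[OF assms(2)] dual_var_complementarity(2)[OF assms(1,2)]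
      threshold(2)[OF assms(2)]
      threshold(1)[OF t] dual_var_complementarity(2)[OF assms(1) t] threshold(2)[OF t]]
  have "lam * dual_var X lam t j \<le> lam * dual_var X lam s j"
    "lam * dual_var X lam s j - lam * dual_var X lam t j \<le> t - s"
    using compare by simp_all
  then show "dual_var X lam t j \<le> dual_var X lam s j"
    and "lam * (dual_var X lam s j - dual_var X lam t j) \<le> t - s"
    using assms(1) by (auto simp: algebra_simps)
qed

lemma dual_var_lipschitz:
  assumes "0 < lam" and "0 < s" and "0 < t"
  shows "\<bar>lam * dual_var X lam s j - lam * dual_var X lam t j\<bar> \<le> \<bar>s - t\<bar>"
proof -
  have *: "\<bar>lam * dual_var X lam s j - lam * dual_var X lam t j\<bar> \<le> \<bar>s - t\<bar>"
    if "0 < s" "s \<le> t" for s t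
    using dual_var_antimono[OF assms(1) that, of X j] assms(1) that
      mult_left_mono[of "dual_var X lam t j" "dual_var X lam s j" lam]
    by (simp add: algebra_simps)
  show ?thesis
    using *[of s t] *[of t s] assms by (cases "s \<le> t") (auto simp: abs_minus_commute)
qed

definition dual_sum :: "real ^ 'm ^ 'n \<Rightarrow> real \<Rightarrow> real \<Rightarrow> real" where
  "dual_sum X lam t = (\<Sum>j\<in>UNIV. dual_var X lam t j)"

lemma dual_sum_antimono:
  "0 < lam \<Longrightarrow> 0 < s \<Longrightarrow> s \<le> t \<Longrightarrow> dual_sum X lam t \<le> dual_sum X lam s"
  unfolding dual_sum_def by (intro sum_mono dual_var_antimono(1))

text \<open>
  If the sums for \<open>s \<le> t\<close> agree, then by monotonicity so do all summands. A column with a positive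
  summand then has one thresholded norm that equals both \<open>s\<close> and \<open>t\<close>.
\<close>

lemma dual_sum_inj:
  assumes "0 < lam" and "0 < s" and "0 < t"
    and "dual_sum X lam s = dual_sum X lam t" and "0 < dual_sum X lam t"
  shows "s = t"
proof -
  have *: "s = t" if "0 < s" "s \<le> t" and eq: "dual_sum X lam s = dual_sum X lam t"
    and pos: "0 < dual_sum X lam t" for s t
  proof -
    have t: "0 < t" using that by simp
    have "\<exists>j. 0 < dual_var X lam t j"
    proof (rule ccontr)
      assume "\<nexists>j. 0 < dual_var X lam t j"
      then have "dual_sum X lam t \<le> 0"
        unfolding dual_sum_def by (intro sum_nonpos) (auto simp: not_less)
      then show False using pos by simp
    qed
    then obtain j where j: "0 < dual_var X lam t j" by blast
    have same: "dual_var X lam t j = dual_var X lam s j"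
      using sum_mono_inv[OF eq[symmetric, unfolded dual_sum_def]
          dual_var_antimono(1)[OF assms(1) that(1,2)], of j] by simp
    have "s = shrunk_norm1 (lam * dual_var X lam s j) (column j X)"
      using dual_var_complementarity(3)[OF assms(1) that(1) j[unfolded same]] by (rule sym)
    also have "\<dots> = t"
      using dual_var_complementarity(3)[OF assms(1) t j] unfolding same .
    finally show ?thesis .
  qed
  show ?thesis using *[of s t] *[of t s] assms by (cases "s \<le> t") auto
qed


section \<open>The optimal dual variables\<close>

text \<open>
  Moving only the \<open>i\<close>-th coordinate of \<open>u\<close> reduces the subgradient inequality to the absolute
  value on the real line.
\<close>

lemma subdifferential_norm1_component:
  fixes u g :: "real ^ 'n"
  assumes "g \<in> subdifferential norm1 u"
  shows "\<bar>g $ i\<bar> \<le> 1" and "g $ i * u $ i = \<bar>u $ i\<bar>"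
proof -
  have *: "\<bar>u $ i\<bar> + g $ i * s \<le> \<bar>u $ i + s\<bar>" for s
  proof -
    have split: "norm1 (u + axis i s) = norm1 u - \<bar>u $ i\<bar> + \<bar>u $ i + s\<bar>"
    proof -
      have "norm1 (u + axis i s) - norm1 u
          = (\<Sum>k\<in>UNIV. \<bar>u $ k + axis i s $ k\<bar> - \<bar>u $ k\<bar>)"
        by (simp add: norm1_def sum_subtractf)
      also have "\<dots> = (\<Sum>k\<in>UNIV. if k = i then \<bar>u $ i + s\<bar> - \<bar>u $ i\<bar> else 0)"
        by (intro sum.cong) (auto simp: axis_def)
      also have "\<dots> = \<bar>u $ i + s\<bar> - \<bar>u $ i\<bar>" by simp
      finally show ?thesis by linarith
    qed
    have "norm1 u + g \<bullet> (u + axis i s - u) \<le> norm1 (u + axis i s)"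
      using assms unfolding subdifferential_def by blast
    then show ?thesis using split by (simp add: inner_axis)
  qed
  show "\<bar>g $ i\<bar> \<le> 1"
    using *[of 1] *[of "-1"] by linarith
  show "g $ i * u $ i = \<bar>u $ i\<bar>"
    using *[of "u $ i"] *[of "- u $ i"] by simp
qed

text \<open>
  Stationarity reads \<open>x = u + \<lambda> \<nu> g\<close>, where \<open>g\<close> is the sign of \<open>u\<close> in the nonzero entries and lies
  in \<open>[-1, 1]\<close> in the others; soft thresholding of \<open>x\<close> at level \<open>\<lambda> \<nu>\<close> undoes this shift.
\<close>

lemma KKT_soft_vec:
  assumes "KKT X lam U t \<nu>" and "0 < lam"
  shows "column j U = soft_vec (lam * \<nu> $ j) (column j X)"
proof -
  let ?u = "column j U" and ?x = "column j X"
  obtain g where g: "g \<in> subdifferential norm1 ?u"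
    and eq: "(1 / lam) *\<^sub>R (?u - ?x) = - (\<nu> $ j) *\<^sub>R g"
    using assms(1) unfolding KKT_def by blast
  have nonneg: "0 \<le> lam * \<nu> $ j" using assms unfolding KKT_def by simp
  have "?u $ i = soft (lam * \<nu> $ j) (?x $ i)" for i
  proof -
    have "(1 / lam) * (?u $ i - ?x $ i) = - (\<nu> $ j) * g $ i"
      using arg_cong[OF eq, of "\<lambda>v. v $ i"] by simp
    then have x: "?x $ i = ?u $ i + (lam * \<nu> $ j) * g $ i"
      using assms(2) by (simp add: field_simps)
    note sub = subdifferential_norm1_component[OF g, of i]
    show ?thesis
    proof (cases "?u $ i = 0")
      case True
      have "\<bar>(lam * \<nu> $ j) * g $ i\<bar> \<le> lam * \<nu> $ j"
        using mult_left_mono[OF sub(1) nonneg] nonneg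
        by (simp only: abs_mult[of "lam * \<nu> $ j"] abs_of_nonneg mult_1_right)
      then show ?thesis using x True by (simp add: soft_def)
    next
      case False
      have "g $ i * ?u $ i = sgn (?u $ i) * ?u $ i"
        unfolding sub(2) by (simp add: sgn_if)
      then have "g $ i = sgn (?u $ i)" using False by simp
      then show ?thesis using x soft_add_sgn[OF nonneg False] by simp
    qed
  qed
  then show ?thesis by (simp add: vec_eq_iff soft_vec_def)
qed

lemma KKT_shrunk_norm1:
  assumes "KKT X lam U t \<nu>" and "0 < lam"
  shows "norm1 (column j U) = shrunk_norm1 (lam * \<nu> $ j) (column j X)"
  using assms norm1_soft_vec[of "lam * \<nu> $ j" "column j X"]
  by (simp add: KKT_soft_vec[OF assms] KKT_def)

text \<open>
  If \<open>t = 0\<close>, every column is thresholded to zero, so \<open>\<lambda> \<nu>\<^sub>j\<close> is at least the largest entry of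
  column \<open>j\<close> in absolute value. Summation over \<open>j\<close> gives \<open>\<lambda> \<ge> \<lambda>\<^sub>m\<^sub>a\<^sub>x\<close>.
\<close>

lemma KKT_slack_pos:
  fixes X U :: "real ^ 'm ^ 'n"
  assumes "KKT X lam U t \<nu>" and "0 < lam" and "lam < lambda_max X"
  shows "0 < t"
proof (rule ccontr)
  assume "\<not> 0 < t"
  have "Max (range (\<lambda>i. \<bar>X $ i $ j\<bar>)) \<le> lam * \<nu> $ j" for j
  proof -
    have "shrunk_norm1 (lam * \<nu> $ j) (column j X) \<le> 0"
      using assms(1) \<open>\<not> 0 < t\<close> KKT_shrunk_norm1[OF assms(1,2), of j]
      by (metis KKT_def not_less order_trans)
    then have "shrunk_norm1 (lam * \<nu> $ j) (column j X) = 0"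
      using shrunk_norm1_nonneg[of "lam * \<nu> $ j" "column j X"] by linarith
    then show ?thesis
      unfolding shrunk_norm1_eq_0_iff by (auto simp: column_def)
  qed
  then have "lambda_max X \<le> (\<Sum>j\<in>UNIV. lam * \<nu> $ j)"
    unfolding lambda_max_def by (intro sum_mono)
  also have "\<dots> = lam"
    using assms(1) by (simp add: KKT_def flip: sum_distrib_left)
  finally show False using assms(3) by simp
qed

text \<open>
  Some \<open>\<nu>\<^sub>j\<close> is positive since they sum to 1, and for this column
  \<open>t = \<parallel>U\<^sub>j\<parallel>\<^sub>1 \<le> \<parallel>X\<^sub>j\<parallel>\<^sub>1\<close>.
\<close>

lemma KKT_slack_le_max:
  fixes X U :: "real ^ 'm ^ 'n"
  assumes "KKT X lam U t \<nu>" and "0 < lam"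
  shows "t \<le> max_col_norm1 X"
proof -
  have "\<exists>j. \<nu> $ j \<noteq> 0"
    using assms(1) unfolding KKT_def by (metis sum.neutral zero_neq_one)
  then obtain j where j: "\<nu> $ j \<noteq> 0" by blast
  then have "t = norm1 (column j U)"
    using assms(1) by (auto simp: KKT_def)
  also have "\<dots> \<le> norm1 (column j X)"
    using KKT_shrunk_norm1[OF assms, of j] assms
      shrunk_norm1_antimono[of 0 "lam * \<nu> $ j" "column j X"]
    by (simp add: KKT_def shrunk_norm1_0)
  also have "\<dots> \<le> max_col_norm1 X"
    unfolding max_col_norm1_def by (intro Max_ge) auto
  finally show ?thesis .
qed

lemma KKT_dual_var:
  assumes "KKT X lam U t \<nu>" and "0 < lam" and "0 < t"
  shows "dual_var X lam t j = \<nu> $ j"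
proof (rule dual_var_eqI[OF assms(2,3)])
  show "0 \<le> \<nu> $ j" using assms(1) by (simp add: KKT_def)
  show "shrunk_norm1 (lam * \<nu> $ j) (column j X) \<le> t"
    using assms(1) by (simp add: KKT_def flip: KKT_shrunk_norm1[OF assms(1,2)])
  show "shrunk_norm1 (lam * \<nu> $ j) (column j X) = t" if "0 < \<nu> $ j"
    using assms(1) that unfolding KKT_def
    by (metis KKT_shrunk_norm1[OF assms(1,2)] eq_iff_diff_eq_0 less_irrefl mult_eq_0_iff)
qed

text \<open>
  A positive \<open>\<nu>\<^sub>j\<close> shifts the nonzero entries of \<open>X\<^sub>j\<close>, hence makes the column both tight and
  thresholded.
\<close>

lemma KKT_inactive_dual_eq_0:
  assumes "KKT X lam U t \<nu>" and "0 < lam" and "column j X \<noteq> 0"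
    and "j \<notin> optimal_active_set X U t"
  shows "\<nu> $ j = 0"
proof (rule ccontr)
  assume "\<nu> $ j \<noteq> 0"
  then have "0 < lam * \<nu> $ j" "norm1 (column j U) = t"
    using assms(1,2) by (auto simp: KKT_def less_le)
  then have "soft_vec (lam * \<nu> $ j) (column j X) = column j X"
    using assms(4) KKT_soft_vec[OF assms(1,2), of j] by (simp add: optimal_active_set_def)
  moreover obtain i where "column j X $ i \<noteq> 0" using assms(3) by (auto simp: vec_eq_iff)
  moreover have "soft \<mu> a \<noteq> a" if "0 < \<mu>" "a \<noteq> 0" for \<mu> a :: real
    using that by (auto simp: soft_def sgn_if max_def abs_if)
  ultimately show False
    using \<open>0 < lam * \<nu> $ j\<close> by (metis soft_vec_def vec_lambda_beta)
qed


section \<open>The bisection loop\<close>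

fun brackets :: "real \<Rightarrow> bisection_state \<Rightarrow> bool" where
  "brackets r (tmin, tmax, t, stop) \<longleftrightarrow>
     0 \<le> tmin \<and> tmin \<le> r \<and> r \<le> tmax \<and> t = (if stop then r else (tmin + tmax) / 2)"

text \<open>
  The number of times that \<open>\<delta>\<close> fits into the bracket drops with every halving, as long as the
  bracket is longer than \<open>\<delta>\<close>; the last summand accounts for the step that only sets the stop flag.
\<close>

fun bisection_measure :: "real \<Rightarrow> bisection_state \<Rightarrow> nat" where
  "bisection_measure \<delta> (tmin, tmax, t, stop) =
     nat \<lfloor>(tmax - tmin) / \<delta>\<rfloor> + (if stop then 0 else 1)"

lemma nat_floor_half_less:
  assumes "1 < (x :: real)"
  shows "nat \<lfloor>x / 2\<rfloor> < nat \<lfloor>x\<rfloor>"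
proof -
  have "1 \<le> \<lfloor>x\<rfloor>" using assms by linarith
  moreover have "2 * \<lfloor>x / 2\<rfloor> \<le> \<lfloor>x\<rfloor>" by linarith
  ultimately show ?thesis by linarith
qed

lemma bisection_step_brackets:
  assumes "0 < lam" and "0 < \<delta>" and "0 < r" and "dual_sum X lam r = 1"
    and "brackets r st" and "bisection_cond \<delta> st"
  shows "brackets r (bisection_step X lam st)
    \<and> bisection_measure \<delta> (bisection_step X lam st) < bisection_measure \<delta> st"
proof -
  obtain a b t stop where st: "st = (a, b, t, stop)" by (cases st)
  have inv: "\<not> stop" "\<delta> < b - a" "0 \<le> a" "a \<le> r" "r \<le> b" "t = (a + b) / 2"
    using assms(5,6) unfolding st by auto
  have t: "0 < t" using inv assms(3) by simp
  have halve: "nat \<lfloor>(b - t) / \<delta>\<rfloor> < nat \<lfloor>(b - a) / \<delta>\<rfloor>"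
    "nat \<lfloor>(t - a) / \<delta>\<rfloor> < nat \<lfloor>(b - a) / \<delta>\<rfloor>"
  proof -
    have "(b - t) / \<delta> = (b - a) / \<delta> / 2" "(t - a) / \<delta> = (b - a) / \<delta> / 2"
      unfolding inv(6) by (simp_all add: field_simps)
    moreover have "1 < (b - a) / \<delta>" using inv(2) assms(2) by simp
    ultimately show "nat \<lfloor>(b - t) / \<delta>\<rfloor> < nat \<lfloor>(b - a) / \<delta>\<rfloor>"
      "nat \<lfloor>(t - a) / \<delta>\<rfloor> < nat \<lfloor>(b - a) / \<delta>\<rfloor>"
      using nat_floor_half_less by presburger+
  qed
  have step: "bisection_step X lam st =
     (if dual_sum X lam t > 1 then (t, b, (t + b) / 2, False)
      else if dual_sum X lam t < 1 then (a, t, (t + a) / 2, False) else (a, b, t, True))"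
    unfolding st by (simp add: dual_sum_def Let_def)
  consider "dual_sum X lam t > 1" | "dual_sum X lam t < 1" | "dual_sum X lam t = 1"
    by linarith
  then show ?thesis
  proof cases
    case 1
    then have "t \<le> r" using dual_sum_antimono[OF assms(1,3), of t X] assms(4) by linarith
    moreover have next_st: "bisection_step X lam st = (t, b, (t + b) / 2, False)"
      unfolding step using 1 by simp
    ultimately show ?thesis
      unfolding next_st st using inv(1,5) t halve(1) by simp
  next
    case 2
    then have "r \<le> t" using dual_sum_antimono[OF assms(1) t, of r X] assms(4) by linarith
    moreover have next_st: "bisection_step X lam st = (a, t, (t + a) / 2, False)"
      unfolding step using 2 by simp
    ultimately show ?thesis
      unfolding next_st st using inv(1,3,4) halve(2) by simp
  next
    case 3
    then have "t = r" using dual_sum_inj[OF assms(1) t assms(3), of X] assms(4) by simp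
    moreover have next_st: "bisection_step X lam st = (a, b, t, True)"
      unfolding step using 3 by simp
    ultimately show ?thesis
      unfolding next_st st using inv(1,3-5) by simp
  qed
qed

lemma bisection_root_bound:
  assumes "0 < lam" and "0 < \<delta>" and "0 < r" and "r \<le> max_col_norm1 X"
    and "dual_sum X lam r = 1"
  obtains a b t stop where
    "bisection X lam \<delta> = Some (bisection_output X lam (a, b, t, stop))"
    and "0 < t" and "\<bar>t - r\<bar> \<le> \<delta> / 2"
proof -
  note step = bisection_step_brackets[OF assms(1,2,3,5)]
  have init: "brackets r (bisection_init X)"
    using assms(3,4) by (simp add: bisection_init_def)
  obtain st where st: "while_option (bisection_cond \<delta>) (bisection_step X lam)
      (bisection_init X) = Some st"
    using measure_while_option_Some[where P = "brackets r" and f = "bisection_measure \<delta>",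
        OF step init] by (rule exE)
  obtain a b t stop where eq: "st = (a, b, t, stop)" by (cases st)
  have "brackets r st"
    by (rule while_option_rule[where P = "brackets r", OF _ st init]) (rule step[THEN conjunct1])
  moreover have "\<not> bisection_cond \<delta> st" by (rule while_option_stop[OF st])
  ultimately have fin: "0 \<le> a" "a \<le> r" "r \<le> b" "t = (if stop then r else (a + b) / 2)"
    "stop \<or> b - a \<le> \<delta>"
    unfolding eq by auto
  have "0 < t \<and> \<bar>t - r\<bar> \<le> \<delta> / 2"
  proof (cases stop)
    case True
    then show ?thesis using fin(4) assms(2,3) by simp
  next
    case False
    then have mid: "2 * t = a + b" and len: "b - a \<le> \<delta>" using fin(4,5) by auto
    have "0 < t" using mid fin(1,3) assms(3) by linarith
    moreover have "\<bar>t - r\<bar> \<le> \<delta> / 2"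
    proof (rule abs_leI)
      show "t - r \<le> \<delta> / 2" using mid len fin(2) by (simp add: field_simps)
      show "- (t - r) \<le> \<delta> / 2" using mid len fin(3) by (simp add: field_simps)
    qed
    ultimately show ?thesis by (rule conjI)
  qed
  moreover have "bisection X lam \<delta> = Some (bisection_output X lam (a, b, t, stop))"
    unfolding bisection_def st eq by (simp only: option.map)
  ultimately show ?thesis using that[of a b t stop] by simp
qed


section \<open>Accuracy of the bisection algorithm\<close>

theorem proposition4:
  fixes X U_star :: "real ^ 'm ^ 'n"
    and nu_star :: "real ^ 'm"
    and t_star lam \<delta> :: real
  assumes "\<And>j. column j X \<noteq> 0"
    and "0 < lam" and "lam < lambda_max X"
    and "0 < \<delta>"
    and "primal_optimal X lam U_star t_star"
    and "KKT X lam U_star t_star nu_star"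
  shows "\<exists>t_hat nu_hat U_hat.
     bisection X lam \<delta> = Some (t_hat, nu_hat, U_hat) \<and>
     (\<forall>j i. \<bar>nu_hat $ j - nu_star $ j\<bar> \<le> \<delta> / lam \<and>
            \<bar>U_hat $ i $ j - U_star $ i $ j\<bar> < \<delta>) \<and>
     (active_set X t_hat = optimal_active_set X U_star t_star \<longrightarrow>
        (\<forall>j. j \<notin> active_set X t_hat \<longrightarrow>
             column j U_hat = column j U_star \<and> nu_hat $ j = nu_star $ j))"
proof -
  note kkt = assms(6)
  have t_star: "0 < t_star" by (rule KKT_slack_pos[OF kkt assms(2,3)])
  have nu_star: "nu_star $ j = dual_var X lam t_star j" for j
    by (simp add: KKT_dual_var[OF kkt assms(2) t_star])
  have U_star: "column j U_star = soft_vec (lam * nu_star $ j) (column j X)" for j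
    by (rule KKT_soft_vec[OF kkt assms(2)])
  have "dual_sum X lam t_star = 1"
    using kkt by (simp add: dual_sum_def KKT_def flip: nu_star)
  then obtain a b t stop where
    run: "bisection X lam \<delta> = Some (bisection_output X lam (a, b, t, stop))"
    and t: "0 < t" and close: "\<bar>t - t_star\<bar> \<le> \<delta> / 2"
    using bisection_root_bound[OF assms(2,4) t_star KKT_slack_le_max[OF kkt assms(2)]]
    by blast
  define nu_hat :: "real ^ 'm" where "nu_hat = (\<chi> j. dual_var X lam t j)"
  define U_hat :: "real ^ 'm ^ 'n" where
    "U_hat = (\<chi> i j. soft_vec (lam * dual_var X lam t j) (column j X) $ i)"
  have U_hat: "column j U_hat = soft_vec (lam * nu_hat $ j) (column j X)" for j
    by (simp add: U_hat_def nu_hat_def column_def vec_eq_iff)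
  have thresholds: "\<bar>lam * nu_hat $ j - lam * nu_star $ j\<bar> \<le> \<delta> / 2" for j
    using dual_var_lipschitz[OF assms(2) t t_star, of X j] close
    by (simp add: nu_hat_def nu_star)
  have "\<bar>nu_hat $ j - nu_star $ j\<bar> \<le> \<delta> / lam" for j
  proof -
    have "lam * \<bar>nu_hat $ j - nu_star $ j\<bar> = \<bar>lam * nu_hat $ j - lam * nu_star $ j\<bar>"
      using assms(2) by (simp add: abs_mult flip: right_diff_distrib)
    also have "\<dots> \<le> \<delta>" using thresholds[of j] assms(4) by linarith
    finally show ?thesis using assms(2) by (simp add: field_simps)
  qed
  moreover have "\<bar>U_hat $ i $ j - U_star $ i $ j\<bar> < \<delta>" for i j
  proof -
    have "U_hat $ i $ j - U_star $ i $ j = column j U_hat $ i - column j U_star $ i"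
      by (simp add: column_def)
    also have "\<dots> = soft (lam * nu_hat $ j) (X $ i $ j) - soft (lam * nu_star $ j) (X $ i $ j)"
      unfolding U_hat U_star by (simp add: soft_vec_def column_def)
    finally show ?thesis
      using soft_lipschitz_level[of "lam * nu_hat $ j" "X $ i $ j" "lam * nu_star $ j"]
        thresholds[of j] assms(4) by linarith
  qed
  moreover have "column j U_hat = column j U_star \<and> nu_hat $ j = nu_star $ j"
    if "active_set X t = optimal_active_set X U_star t_star" "j \<notin> active_set X t" for j
  proof -
    have "nu_hat $ j = 0" using that(2) by (simp add: nu_hat_def dual_var_def)
    moreover have "nu_star $ j = 0"
      using KKT_inactive_dual_eq_0[OF kkt assms(2) assms(1)] that by simp
    ultimately show ?thesis by (simp add: U_hat U_star)
  qed
  moreover have "bisection X lam \<delta> = Some (t, nu_hat, U_hat)"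
    by (simp add: run nu_hat_def U_hat_def)
  ultimately show ?thesis by blast
qed

end
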